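(* Let $T=(T_1,T_2)$ be a pair of commuting isometries on a Hilbert space $\mathcal{H}$ satisfying $T_1^2=T_2^2$. Then there is a decomposition $\mathcal{H}=\mathcal{M}_+\oplus\mathcal{M}_-\oplus\mathcal{K}$, isometries $W_+$ on $\mathcal{M}_+$ and $W_-$ on $\mathcal{M}_-$, and operators $E_+:\mathcal{K}\to\mathcal{M}_+$ and $E_-:\mathcal{K}\to\mathcal{M}_-$ satisfying $E_+^*E_++E_-^*E_-=I$, $W_+^*E_+=0$ and $W_-^*E_-=0$, so that, with respect to the decomposition $\mathcal{M}_+\oplus\mathcal{M}_-\oplus\mathcal{K}$ (in this order), $$T_1\cong\begin{pmatrix}W_+&0&E_+\\0&W_-&E_-\\0&0&0\end{pmatrix},\qquad T_2\cong\begin{pmatrix}W_+&0&E_+\\0&-W_-&-E_-\\0&0&0\end{pmatrix}.$$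
   Context: Hilbert spaces are complex; $\oplus$ denotes orthogonal direct sum (summands may be zero). *)

theory Defs
  imports "HOL-Analysis.Analysis"
begin

text \<open>
  The class \<open>chilbert_space\<close> of complex Hilbert spaces is built on top of \<open>real_inner\<close>: the
  underlying real structure of a complex inner product space is the real part of the complex
  inner product, so norm and topology are those of the library.  The complex inner product is
  linear in its first argument.
\<close>

class complex_vector = real_vector +
  fixes scaleC :: "complex \<Rightarrow> 'a \<Rightarrow> 'a"  (infixr \<open>*\<^sub>C\<close> 75)
  assumes scaleC_add_right: "a *\<^sub>C (x + y) = a *\<^sub>C x + a *\<^sub>C y"
    and scaleC_add_left: "(a + b) *\<^sub>C x = a *\<^sub>C x + b *\<^sub>C x"
    and scaleC_scaleC: "a *\<^sub>C (b *\<^sub>C x) = (a * b) *\<^sub>C x"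
    and scaleC_one: "1 *\<^sub>C x = x"
    and scaleR_scaleC: "r *\<^sub>R x = complex_of_real r *\<^sub>C x"

global_interpretation complex_vector:
  vector_space "scaleC :: complex \<Rightarrow> 'a \<Rightarrow> 'a :: complex_vector"
  by unfold_locales (rule scaleC_add_right scaleC_add_left scaleC_scaleC scaleC_one)+

class complex_inner = complex_vector + real_inner +
  fixes cinner :: "'a \<Rightarrow> 'a \<Rightarrow> complex"
  assumes cinner_commute: "cinner x y = cnj (cinner y x)"
    and cinner_add_left: "cinner (x + y) z = cinner x z + cinner y z"
    and cinner_scaleC_left: "cinner (a *\<^sub>C x) y = a * cinner x y"
    and inner_eq_Re_cinner: "inner x y = Re (cinner x y)"

class chilbert_space = complex_inner + complete_space

definition closed_csubspace :: "'a :: chilbert_space set \<Rightarrow> bool" where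
  "closed_csubspace M \<longleftrightarrow> complex_vector.subspace M \<and> closed M"

text \<open>
  Operators between closed subspaces \<open>M\<close> and \<open>N\<close> are represented by functions on the ambient
  space, whose values outside \<open>M\<close> are irrelevant.
\<close>

definition linear_between :: "'a :: chilbert_space set \<Rightarrow> 'a set \<Rightarrow> ('a \<Rightarrow> 'a) \<Rightarrow> bool" where
  "linear_between M N f \<longleftrightarrow>
     (\<forall>x\<in>M. f x \<in> N) \<and>
     (\<forall>x\<in>M. \<forall>y\<in>M. f (x + y) = f x + f y) \<and>
     (\<forall>a. \<forall>x\<in>M. f (a *\<^sub>C x) = a *\<^sub>C f x)"

definition operator_between :: "'a :: chilbert_space set \<Rightarrow> 'a set \<Rightarrow> ('a \<Rightarrow> 'a) \<Rightarrow> bool" where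
  "operator_between M N f \<longleftrightarrow>
     linear_between M N f \<and> (\<exists>B. \<forall>x\<in>M. norm (f x) \<le> B * norm x)"

definition isometry_on :: "'a :: chilbert_space set \<Rightarrow> ('a \<Rightarrow> 'a) \<Rightarrow> bool" where
  "isometry_on M f \<longleftrightarrow> linear_between M M f \<and> (\<forall>x\<in>M. norm (f x) = norm x)"

text \<open>
  The adjoint, from \<open>N\<close> to \<open>M\<close>, of an operator \<open>f\<close> from \<open>M\<close> to \<open>N\<close>.  By the Riesz
  representation theorem the description is proper whenever \<open>M\<close> is a closed subspace and \<open>f\<close> is
  bounded.
\<close>

definition adjoint_between ::
    "'a :: chilbert_space set \<Rightarrow> 'a set \<Rightarrow> ('a \<Rightarrow> 'a) \<Rightarrow> 'a \<Rightarrow> 'a" where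
  "adjoint_between M N f y =
     (if y \<in> N then THE z. z \<in> M \<and> (\<forall>x\<in>M. cinner (f x) y = cinner x z) else 0)"

definition orthogonal_decomposition :: "'a :: chilbert_space set list \<Rightarrow> bool" where
  "orthogonal_decomposition Ms \<longleftrightarrow>
     (\<forall>i<length Ms. closed_csubspace (Ms ! i)) \<and>
     (\<forall>i<length Ms. \<forall>j<length Ms. i \<noteq> j \<longrightarrow>
        (\<forall>x\<in>Ms ! i. \<forall>y\<in>Ms ! j. cinner x y = 0)) \<and>
     (\<forall>x. \<exists>c. (\<forall>i<length Ms. c i \<in> Ms ! i) \<and> x = (\<Sum>i<length Ms. c i))"

text \<open>
  \<open>T\<close> is the operator with block matrix \<open>A\<close>, given as its list of rows, with respect to the
  decomposition \<open>Ms\<close> of the whole space; the entry in row \<open>i\<close> and column \<open>j\<close> is an operator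
  from \<open>Ms ! j\<close> to \<open>Ms ! i\<close>.
\<close>

definition has_block_matrix ::
    "'a :: chilbert_space set list \<Rightarrow> ('a \<Rightarrow> 'a) list list \<Rightarrow> ('a \<Rightarrow> 'a) \<Rightarrow> bool" where
  "has_block_matrix Ms A T \<longleftrightarrow>
     length A = length Ms \<and> (\<forall>row\<in>set A. length row = length Ms) \<and>
     (\<forall>i<length Ms. \<forall>j<length Ms. operator_between (Ms ! j) (Ms ! i) (A ! i ! j)) \<and>
     (\<forall>c. (\<forall>j<length Ms. c j \<in> Ms ! j) \<longrightarrow>
        T (\<Sum>j<length Ms. c j) = (\<Sum>i<length Ms. \<Sum>j<length Ms. (A ! i ! j) (c j)))"

end

theory Submission
  imports Defs
begin

text \<open>
  Take for \<open>\<M>\<^sub>+\<close> and \<open>\<M>\<^sub>-\<close> the subspaces on which \<open>T\<^sub>1 = T\<^sub>2\<close> and \<open>T\<^sub>1 = - T\<^sub>2\<close>, and for \<open>\<K>\<close>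
  the orthogonal complement of their sum.  With \<open>S = (T\<^sub>1 + T\<^sub>2) / 2\<close> and \<open>D = (T\<^sub>1 - T\<^sub>2) / 2\<close>
  one has \<open>S D = D S = 0\<close>, so \<open>S\<close> maps into \<open>\<M>\<^sub>+ = ker D\<close> and \<open>D\<close> into \<open>\<M>\<^sub>- = ker S\<close>, while
  \<open>S\<^sup>* S + D\<^sup>* D = I\<close> because \<open>T\<^sub>1\<close> and \<open>T\<^sub>2\<close> are isometries.  Everything follows with
  \<open>W\<^sub>\<plusminus> = T\<^sub>1\<close> on \<open>\<M>\<^sub>\<plusminus>\<close>, \<open>E\<^sub>+ = S\<close> and \<open>E\<^sub>- = D\<close> on \<open>\<K>\<close>.
\<close>

section \<open>Orthogonal projection\<close>

text \<open>This is the parallelogram law for \<open>x - y\<close> and \<open>x - z\<close>. It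
  turns the near-minimality of two distances from \<open>x\<close> into closeness of
  \<open>y\<close> and \<open>z\<close>.\<close>

lemma parallelogram_midpoint:
  fixes x y z :: "'a::real_inner"
  shows "(norm (y - z))\<^sup>2 =
    2 * (norm (x - y))\<^sup>2 + 2 * (norm (x - z))\<^sup>2 - 4 * (norm (x - (1/2) *\<^sub>R (y + z)))\<^sup>2"
  unfolding power2_norm_eq_inner
  by (simp add: inner_diff_left inner_diff_right inner_add_left inner_add_right
      inner_commute[of y x] inner_commute[of z x] inner_commute[of z y] algebra_simps)

text \<open>The approximate minimisers of the squared distance form a decreasing sequence of
  nonempty closed sets. Their diameters shrink to 0, so by completeness they meet in a single point,
  which attains the infimum.\<close>

lemma closed_subspace_nearest_point:
  fixes M :: "'a::{real_inner,complete_space} set"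
  assumes "subspace M" and "closed M"
  obtains y where "y \<in> M" and "\<And>m. m \<in> M \<Longrightarrow> norm (x - y) \<le> norm (x - m)"
proof -
  define d where "d = (INF m\<in>M. (norm (x - m))\<^sup>2)"
  define A where "A n = {m \<in> M. (norm (x - m))\<^sup>2 \<le> d + 1 / real (Suc n)}" for n
  have ne: "M \<noteq> {}" using subspace_0[OF \<open>subspace M\<close>] by blast
  have bdd: "bdd_below ((\<lambda>m. (norm (x - m))\<^sup>2) ` M)"
    by (rule bdd_belowI[of _ 0]) auto
  have d_le: "d \<le> (norm (x - m))\<^sup>2" if "m \<in> M" for m
    unfolding d_def by (rule cINF_lower[OF bdd that])
  have "\<exists>a. \<Inter>(range A) = {a}"
  proof (rule decreasing_closed_nest_sing)
    fix n
    have "A n = M \<inter> {m. (norm (x - m))\<^sup>2 \<le> d + 1 / real (Suc n)}"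
      by (auto simp: A_def)
    moreover have "closed {m. (norm (x - m))\<^sup>2 \<le> d + 1 / real (Suc n)}"
      by (intro closed_Collect_le continuous_intros)
    ultimately show "closed (A n)" using \<open>closed M\<close> by auto
    have "d < d + 1 / real (Suc n)" by simp
    then obtain m where "m \<in> M" "(norm (x - m))\<^sup>2 < d + 1 / real (Suc n)"
      using cINF_less_iff[OF ne bdd] unfolding d_def by blast
    then show "A n \<noteq> {}" by (auto simp: A_def intro: less_imp_le)
  next
    fix m n :: nat assume "m \<le> n"
    then have "1 / real (Suc n) \<le> 1 / real (Suc m)" by (simp add: frac_le)
    then show "A n \<subseteq> A m" unfolding A_def by auto
  next
    fix e :: real assume "e > 0"
    then obtain n where n: "1 / real (Suc n) < e\<^sup>2 / 4"
      using reals_Archimedean[of "e\<^sup>2 / 4"] by (auto simp: inverse_eq_divide)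
    have "dist y z < e" if "y \<in> A n" "z \<in> A n" for y z
    proof -
      \<comment> \<open>The midpoint competes in the infimum, so its squared distance from
        \<open>x\<close> is at least \<open>d\<close>. In the parallelogram identity the terms in
        \<open>d\<close> then cancel.\<close>
      have "(1/2) *\<^sub>R (y + z) \<in> M"
        using that \<open>subspace M\<close> by (auto simp: A_def intro!: subspace_mul subspace_add)
      from d_le[OF this] parallelogram_midpoint[of y z x] that
      have "(norm (y - z))\<^sup>2 \<le> 4 * (1 / real (Suc n))" by (auto simp: A_def)
      also have "\<dots> < e\<^sup>2" using n by simp
      finally show ?thesis using \<open>e > 0\<close> by (simp add: dist_norm power2_less_imp_less)
    qed
    then show "\<exists>n. \<forall>x\<in>A n. \<forall>y\<in>A n. dist x y < e" by blast
  qed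
  then obtain y where y: "y \<in> A n" for n by blast
  have "(norm (x - y))\<^sup>2 \<le> d"
  proof (rule field_le_epsilon)
    fix e :: real assume "e > 0"
    then obtain n where "1 / real (Suc n) < e"
      using reals_Archimedean by (auto simp: inverse_eq_divide)
    then show "(norm (x - y))\<^sup>2 \<le> d + e" using y[of n] by (auto simp: A_def)
  qed
  then have "norm (x - y) \<le> norm (x - m)" if "m \<in> M" for m
    using d_le[OF that] by (meson norm_ge_zero order_trans power2_le_imp_le)
  then show thesis using y[of 0] that by (auto simp: A_def)
qed

lemma closed_subspace_projection:
  fixes M :: "'a::{real_inner,complete_space} set"
  assumes "subspace M" and "closed M"
  obtains y where "y \<in> M" and "\<And>m. m \<in> M \<Longrightarrow> inner (x - y) m = 0"
proof -
  obtain y where y: "y \<in> M" and min: "\<And>m. m \<in> M \<Longrightarrow> norm (x - y) \<le> norm (x - m)"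
    using closed_subspace_nearest_point[OF assms] by metis
  have "inner (x - y) m = 0" if m: "m \<in> M" for m
  proof (cases "m = 0")
    case False
    \<comment> \<open>This \<open>t\<close> minimises the norm of
      \<open>x - y - t *\<^sub>R m\<close>. Unless the inner product vanishes, the resulting point
      of \<open>M\<close> would be strictly closer to \<open>x\<close> than \<open>y\<close>
      is.\<close>
    define t where "t = inner (x - y) m / inner m m"
    have "y + t *\<^sub>R m \<in> M"
      using y m \<open>subspace M\<close> by (intro subspace_add subspace_mul)
    then have "(norm (x - y))\<^sup>2 \<le> (norm (x - y - t *\<^sub>R m))\<^sup>2"
      using min by (simp add: diff_diff_add power_mono)
    also have "\<dots> = (norm (x - y))\<^sup>2 - 2 * t * inner (x - y) m + t * t * inner m m"
      unfolding power2_norm_eq_inner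
      by (simp add: inner_diff_left[of "x - y"] inner_diff_right[of _ "x - y"]
          inner_commute[of m "x - y"] right_diff_distrib)
    also have "\<dots> = (norm (x - y))\<^sup>2 - (inner (x - y) m)\<^sup>2 / inner m m"
      using False by (simp add: t_def power2_eq_square)
    finally have "(inner (x - y) m)\<^sup>2 / inner m m \<le> 0" by simp
    moreover have "inner m m > 0" using False by simp
    ultimately show ?thesis by (simp add: divide_le_0_iff)
  qed simp
  with y that show thesis by blast
qed

section \<open>Complex inner products\<close>

lemma cinner_add_right: "cinner x (y + z) = cinner x y + cinner x z"
  for x :: "'a::complex_inner"
  by (metis cinner_add_left cinner_commute complex_cnj_add)

lemma cinner_scaleC_right: "cinner x (a *\<^sub>C y) = cnj a * cinner x y"
  for x :: "'a::complex_inner"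
  by (metis cinner_commute cinner_scaleC_left complex_cnj_mult)

lemma scaleC_minus_one: "(-1) *\<^sub>C x = - x" for x :: "'a::complex_vector"
  by (metis complex_vector.scale_minus_left scaleC_one)

lemma cinner_minus_left: "cinner (- x) y = - cinner x y" for x :: "'a::complex_inner"
  by (metis cinner_scaleC_left mult_minus1 scaleC_minus_one)

lemma cinner_minus_right: "cinner x (- y) = - cinner x y" for x :: "'a::complex_inner"
  by (metis cinner_commute cinner_minus_left complex_cnj_minus)

lemma cinner_diff_left: "cinner (x - y) z = cinner x z - cinner y z"
  for x :: "'a::complex_inner"
  by (metis cinner_add_left cinner_minus_left diff_conv_add_uminus)

lemma cinner_diff_right: "cinner x (y - z) = cinner x y - cinner x z"
  for x :: "'a::complex_inner"
  by (metis cinner_add_right cinner_minus_right diff_conv_add_uminus)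

lemma cinner_zero_left: "cinner 0 x = 0" for x :: "'a::complex_inner"
  by (metis cinner_diff_left diff_self)

lemma cinner_zero_right: "cinner x 0 = 0" for x :: "'a::complex_inner"
  by (metis cinner_diff_right diff_self)

lemma cinner_eq_zero_sym: "cinner x y = 0 \<Longrightarrow> cinner y x = 0" for x :: "'a::complex_inner"
  by (metis cinner_commute complex_cnj_zero)

lemma cinner_self_eq_zero: "cinner x x = 0 \<Longrightarrow> x = 0" for x :: "'a::complex_inner"
  by (metis inner_eq_Re_cinner inner_eq_zero_iff zero_complex.sel(1))

text \<open>The imaginary part of \<open>cinner x y\<close> is the real part of
  \<open>-\<i> * cinner x y\<close>, which is \<open>cinner x (\<i> *\<^sub>C y)\<close>. Complex
  orthogonality thus becomes two real conditions.\<close>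

lemma cinner_eq_Complex: "cinner x y = Complex (inner x y) (inner x (\<i> *\<^sub>C y))"
  for x :: "'a::complex_inner"
  by (simp add: complex_eq_iff inner_eq_Re_cinner cinner_scaleC_right)

lemma complex_subspace_imp_subspace: "complex_vector.subspace M \<Longrightarrow> subspace M"
  by (simp add: complex_vector.subspace_def real_vector.subspace_def scaleR_scaleC)

text \<open>The real projection already works: a complex subspace contains
  \<open>\<i> *\<^sub>C m\<close> along with \<open>m\<close>, so both parts of the complex inner
  product vanish.\<close>

lemma closed_csubspace_projection:
  assumes "closed_csubspace M"
  obtains y where "y \<in> M" and "\<And>m. m \<in> M \<Longrightarrow> cinner (x - y) m = 0"
proof -
  have M: "complex_vector.subspace M" "closed M"
    using assms by (auto simp: closed_csubspace_def)
  obtain y where "y \<in> M" and y: "\<And>m. m \<in> M \<Longrightarrow> inner (x - y) m = 0"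
    using closed_subspace_projection[OF complex_subspace_imp_subspace[OF M(1)] M(2)] by metis
  have "cinner (x - y) m = 0" if "m \<in> M" for m
    using y[OF that] y[OF complex_vector.subspace_scale[OF M(1) that, of \<i>]]
    by (simp add: cinner_eq_Complex complex_eq_iff)
  with \<open>y \<in> M\<close> that show thesis by blast
qed

definition orthocomplement :: "'a::complex_inner set \<Rightarrow> 'a set" where
  "orthocomplement A = {x. \<forall>a\<in>A. cinner x a = 0}"

lemma closed_csubspace_orthocomplement:
  "closed_csubspace (orthocomplement A)" for A :: "'a::chilbert_space set"
proof -
  have "orthocomplement A = (\<Inter>a\<in>A. {x. inner x a = 0} \<inter> {x. inner x (\<i> *\<^sub>C a) = 0})"
    by (auto simp: orthocomplement_def cinner_eq_Complex complex_eq_iff)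
  also have "closed \<dots>"
    by (intro closed_INT ballI closed_Int closed_Collect_eq continuous_intros)
  finally show ?thesis
    by (simp add: closed_csubspace_def complex_vector.subspace_def)
      (simp add: orthocomplement_def cinner_zero_left cinner_add_left cinner_scaleC_left)
qed

text \<open>Two vectors of \<open>M\<close> representing the same functional on \<open>M\<close>
  differ by a vector of \<open>M\<close> orthogonal to itself. Exhibiting one representative
  therefore evaluates the definite description.\<close>

lemma adjoint_between_eqI:
  assumes "complex_vector.subspace M" and "y \<in> N" and "z \<in> M"
    and z: "\<And>x. x \<in> M \<Longrightarrow> cinner (f x) y = cinner x z"
  shows "adjoint_between M N f y = z"
proof -
  have "w = z" if "w \<in> M" "\<forall>x\<in>M. cinner (f x) y = cinner x w" for w
  proof -
    have "w - z \<in> M"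
      using complex_vector.subspace_diff assms(1,3) that(1) by blast
    then have "cinner (w - z) (w - z) = 0"
      using that(2) z by (simp add: cinner_diff_right)
    then show ?thesis using cinner_self_eq_zero by fastforce
  qed
  then have "(THE z. z \<in> M \<and> (\<forall>x\<in>M. cinner (f x) y = cinner x z)) = z"
    using assms by (intro the_equality) auto
  then show ?thesis using \<open>y \<in> N\<close> by (simp add: adjoint_between_def)
qed

section \<open>Isometries\<close>

locale isometry =
  fixes T :: "'a::chilbert_space \<Rightarrow> 'a"
  assumes isometry: "isometry_on UNIV T"
begin

lemma add: "T (x + y) = T x + T y"
  and scaleC: "T (a *\<^sub>C x) = a *\<^sub>C T x"
  and norm: "norm (T x) = norm x"
  using isometry by (auto simp: isometry_on_def linear_between_def)

lemma minus: "T (- x) = - T x"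
  by (metis scaleC scaleC_minus_one)

lemma diff: "T (x - y) = T x - T y"
  by (metis add minus diff_conv_add_uminus)

lemma zero: "T 0 = 0"
  by (metis diff diff_self)

lemma scaleR: "T (r *\<^sub>R x) = r *\<^sub>R T x"
  by (simp add: scaleC scaleR_scaleC)

text \<open>Polarisation recovers the real inner product from norms; complex linearity then gives
  the imaginary part.\<close>

lemma cinner: "cinner (T x) (T y) = cinner x y"
proof -
  have "inner (T x) (T y) = inner x y" for x y
    unfolding dot_norm by (simp flip: add add: norm)
  then show ?thesis by (simp add: cinner_eq_Complex flip: scaleC)
qed

lemma linear: "bounded_linear T"
  by (rule bounded_linear_intro[of _ 1]) (simp_all add: add scaleR norm)

lemma continuous: "continuous_on A T"
  using linear by (rule linear_continuous_on)

lemma closed_csubspace_range: "closed_csubspace (range T)"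
proof -
  have "closed (range T)"
    by (rule complete_imp_closed, rule complete_isometric_image[of 1])
      (simp_all add: linear norm complete_UNIV)
  moreover have "complex_vector.subspace (range T)"
    unfolding complex_vector.subspace_def
    by (auto simp flip: add scaleC) (metis zero rangeI)
  ultimately show ?thesis by (simp add: closed_csubspace_def)
qed

text \<open>The vector \<open>u\<close> is the adjoint of \<open>T\<close> applied to
  \<open>y\<close>. It is the preimage of the projection of \<open>y\<close> onto the closed range
  of \<open>T\<close>, since the remainder is orthogonal to every \<open>T x\<close>.\<close>

lemma adjoint_exists:
  obtains u where "\<And>x. cinner (T x) y = cinner x u"
proof -
  obtain w where "w \<in> range T" and w: "\<And>m. m \<in> range T \<Longrightarrow> cinner (y - w) m = 0"
    using closed_csubspace_projection[OF closed_csubspace_range] by metis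
  then obtain u where u: "w = T u" by blast
  have "cinner (T x) y = cinner x u" for x
    using cinner_eq_zero_sym[OF w[OF rangeI, of x]] by (simp add: cinner_diff_right u cinner)
  then show thesis by (rule that)
qed

end

section \<open>The decomposition\<close>

theorem theorem9p11:
  fixes T1 T2 :: "'a :: chilbert_space \<Rightarrow> 'a"
  assumes "isometry_on UNIV T1" and "isometry_on UNIV T2"
    and "T1 \<circ> T2 = T2 \<circ> T1"
    and "T1 \<circ> T1 = T2 \<circ> T2"
  shows "\<exists>Mp Mm K :: 'a set. \<exists>Wp Wm Ep Em :: 'a \<Rightarrow> 'a.
    orthogonal_decomposition [Mp, Mm, K] \<and>
    isometry_on Mp Wp \<and> isometry_on Mm Wm \<and>
    operator_between K Mp Ep \<and> operator_between K Mm Em \<and>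
    (\<forall>k\<in>K. adjoint_between K Mp Ep (Ep k) + adjoint_between K Mm Em (Em k) = k) \<and>
    (\<forall>k\<in>K. adjoint_between Mp Mp Wp (Ep k) = 0) \<and>
    (\<forall>k\<in>K. adjoint_between Mm Mm Wm (Em k) = 0) \<and>
    has_block_matrix [Mp, Mm, K]
      [[Wp,       \<lambda>_. 0,    Ep],
       [\<lambda>_. 0,    Wm,       Em],
       [\<lambda>_. 0,    \<lambda>_. 0,    \<lambda>_. 0]] T1 \<and>
    has_block_matrix [Mp, Mm, K]
      [[Wp,       \<lambda>_. 0,          Ep],
       [\<lambda>_. 0,    \<lambda>x. - Wm x,     \<lambda>x. - Em x],
       [\<lambda>_. 0,    \<lambda>_. 0,          \<lambda>_. 0]] T2"
proof -
  interpret T1: isometry T1 using assms(1) by unfold_locales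
  interpret T2: isometry T2 using assms(2) by unfold_locales
  have T12: "T1 (T2 x) = T2 (T1 x)" and T11: "T1 (T1 x) = T2 (T2 x)" for x
    using assms(3,4) by (auto simp: fun_eq_iff)
  define Mp where "Mp = {x. T1 x = T2 x}"
  define Mm where "Mm = {x. T1 x = - T2 x}"
  define K where "K = orthocomplement (Mp \<union> Mm)"
  define S where "S x = (1/2) *\<^sub>C (T1 x + T2 x)" for x
  define D where "D x = (1/2) *\<^sub>C (T1 x - T2 x)" for x

  \<comment> \<open>The three orthogonal summands\<close>
  have Mp: "closed_csubspace Mp"
    unfolding closed_csubspace_def complex_vector.subspace_def Mp_def
    by (auto simp: T1.zero T2.zero T1.add T2.add T1.scaleC T2.scaleC
        intro!: closed_Collect_eq T1.continuous T2.continuous)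
  have Mm: "closed_csubspace Mm"
    unfolding closed_csubspace_def complex_vector.subspace_def Mm_def
    by (auto simp: T1.zero T2.zero T1.add T2.add T1.scaleC T2.scaleC
        intro!: closed_Collect_eq T1.continuous T2.continuous continuous_on_minus)
  have K: "closed_csubspace K"
    unfolding K_def by (rule closed_csubspace_orthocomplement)
  have sub: "complex_vector.subspace Mp" "complex_vector.subspace Mm" "complex_vector.subspace K"
    using Mp Mm K by (simp_all add: closed_csubspace_def)

  have MpMm: "cinner x y = 0" if "x \<in> Mp" "y \<in> Mm" for x y
  proof -
    \<comment> \<open>Passing through \<open>T1\<close> and returning through \<open>T2\<close>
      shows that the inner product equals its own negative.\<close>
    have "cinner x y = cinner (T1 x) (T1 y)" by (simp add: T1.cinner)
    also have "\<dots> = - cinner (T2 x) (T2 y)"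
      using that by (simp add: Mp_def Mm_def cinner_minus_right)
    finally show ?thesis by (simp add: T2.cinner)
  qed
  have KMp: "cinner k x = 0" if "k \<in> K" "x \<in> Mp" for k x
    using that by (simp add: K_def orthocomplement_def)
  have KMm: "cinner k x = 0" if "k \<in> K" "x \<in> Mm" for k x
    using that by (simp add: K_def orthocomplement_def)

  have decomp: "\<exists>a b c. a \<in> Mp \<and> b \<in> Mm \<and> c \<in> K \<and> x = a + b + c" for x
  proof -
    obtain a where a: "a \<in> Mp" "\<And>m. m \<in> Mp \<Longrightarrow> cinner (x - a) m = 0"
      using closed_csubspace_projection[OF Mp] by metis
    obtain b where b: "b \<in> Mm" "\<And>m. m \<in> Mm \<Longrightarrow> cinner (x - a - b) m = 0"
      using closed_csubspace_projection[OF Mm] by metis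
    \<comment> \<open>Subtracting \<open>b\<close> preserves orthogonality to \<open>Mp\<close>,
      because \<open>b\<close> lies in \<open>Mm\<close>. Hence two successive projections
      suffice.\<close>
    have "cinner (x - a - b) m = 0" if "m \<in> Mp" for m
      using a(2)[OF that] cinner_eq_zero_sym[OF MpMm[OF that b(1)]]
      by (simp add: cinner_diff_left[of "x - a"])
    then have "x - a - b \<in> K"
      using b(2) by (auto simp: K_def orthocomplement_def)
    moreover have "x = a + b + (x - a - b)" by simp
    ultimately show ?thesis using a(1) b(1) by blast
  qed

  have decomposition: "orthogonal_decomposition [Mp, Mm, K]"
  proof -
    have "\<exists>c. (\<forall>i<3. c i \<in> [Mp, Mm, K] ! i) \<and> x = (\<Sum>i<3. c i)" for x
    proof -
      obtain a b k where "a \<in> Mp" "b \<in> Mm" "k \<in> K" "x = a + b + k" using decomp by blast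
      then show ?thesis
        by (intro exI[of _ "\<lambda>i::nat. [a, b, k] ! i"])
          (auto simp: eval_nat_numeral less_Suc_eq)
    qed
    then show ?thesis
      unfolding orthogonal_decomposition_def
      using Mp Mm K MpMm KMp KMm
      by (auto simp: less_Suc_eq eval_nat_numeral intro: cinner_eq_zero_sym)
  qed

  \<comment> \<open>The matrix entries as operators\<close>
  have S_Mp: "S x \<in> Mp" for x
    by (simp add: S_def Mp_def T1.scaleC T2.scaleC T1.add T2.add T12 T11 add.commute)
  have D_Mm: "D x \<in> Mm" for x
    by (simp add: D_def Mm_def T1.scaleC T2.scaleC T1.diff T2.diff T12 T11
        flip: complex_vector.scale_minus_right)
  have T1_Mp: "T1 x \<in> Mp" if "x \<in> Mp" for x
    using that T11[of x] T12[of x] by (simp add: Mp_def)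
  have T1_Mm: "T1 x \<in> Mm" if "x \<in> Mm" for x
    using that T11[of x] T12[of x] by (simp add: Mm_def T2.minus)

  have norm_half: "norm ((1/2) *\<^sub>C z) = norm z / 2" for z :: 'a
    using norm_scaleR[of "1/2" z] by (simp add: scaleR_scaleC)
  have S_le: "norm (S x) \<le> norm x" for x
    using norm_triangle_ineq[of "T1 x" "T2 x"] by (simp add: S_def norm_half T1.norm T2.norm)
  have D_le: "norm (D x) \<le> norm x" for x
    using norm_triangle_ineq4[of "T1 x" "T2 x"] by (simp add: D_def norm_half T1.norm T2.norm)
  have S_lin: "S (x + y) = S x + S y" "S (a *\<^sub>C x) = a *\<^sub>C S x" for x y a
    by (simp_all add: S_def T1.add T2.add T1.scaleC T2.scaleC algebra_simps scaleC_scaleC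
        complex_vector.scale_right_distrib)
  have D_lin: "D (x + y) = D x + D y" "D (a *\<^sub>C x) = a *\<^sub>C D x" for x y a
    by (simp_all add: D_def T1.add T2.add T1.scaleC T2.scaleC algebra_simps scaleC_scaleC
        complex_vector.scale_right_distrib complex_vector.scale_right_diff_distrib)
  have T1_eq: "T1 x = S x + D x" and T2_eq: "T2 x = S x - D x" for x
  proof -
    have half: "(1/2) *\<^sub>C z + (1/2) *\<^sub>C z = z" for z :: 'a
      by (simp add: scaleC_one flip: scaleC_add_left)
    show "T1 x = S x + D x" "T2 x = S x - D x"
      using half[of "T1 x"] half[of "T2 x"]
      by (simp_all add: S_def D_def complex_vector.scale_right_distrib
          complex_vector.scale_right_diff_distrib)
  qed

  have S_op: "operator_between K Mp S"
    unfolding operator_between_def linear_between_def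
    using S_Mp S_lin S_le by (metis mult_1)
  have D_op: "operator_between K Mm D"
    unfolding operator_between_def linear_between_def
    using D_Mm D_lin D_le by (metis mult_1)
  have mD_op: "operator_between K Mm (\<lambda>x. - D x)"
    using D_op complex_vector.subspace_neg[OF sub(2)]
    by (simp add: operator_between_def linear_between_def)
  have W: "isometry_on Mp T1" "isometry_on Mm T1"
    unfolding isometry_on_def linear_between_def
    by (simp_all add: T1_Mp T1_Mm T1.add T1.scaleC T1.norm)
  have W_op: "operator_between Mp Mp T1" "operator_between Mm Mm T1"
    using W unfolding isometry_on_def operator_between_def by (metis mult_1 order_refl)+
  have mW_op: "operator_between Mm Mm (\<lambda>x. - T1 x)"
    using W_op(2) complex_vector.subspace_neg[OF sub(2)]
    by (simp add: operator_between_def linear_between_def)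
  have zero_op: "operator_between M N (\<lambda>_. 0)" if "complex_vector.subspace N" for M N :: "'a set"
    using complex_vector.subspace_0[OF that]
    by (auto simp: operator_between_def linear_between_def intro: exI[of _ 0])

  \<comment> \<open>Relations between the adjoints\<close>
  have isometry_SD: "cinner (S x) (S y) + cinner (D x) (D y) = cinner x y" for x y
  proof -
    \<comment> \<open>The mixed terms in \<open>T1\<close> and \<open>T2\<close> cancel between the
      two summands.\<close>
    have "cinner (S x) (S y) + cinner (D x) (D y) =
        (cinner (T1 x) (T1 y) + cinner (T2 x) (T2 y)) / 2"
      by (simp add: S_def D_def cinner_scaleC_left cinner_scaleC_right cinner_add_left
          cinner_add_right cinner_diff_left cinner_diff_right field_simps)
    then show ?thesis by (simp add: T1.cinner T2.cinner)
  qed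

  have adjoint_E: "adjoint_between K Mp S (S k) + adjoint_between K Mm D (D k) = k"
    if k: "k \<in> K" for k
  proof -
    obtain u where u: "\<And>x. cinner (T1 x) (S k) = cinner x u"
      using T1.adjoint_exists by metis
    obtain v where v: "\<And>x. cinner (T2 x) (S k) = cinner x v"
      using T2.adjoint_exists by metis
    \<comment> \<open>On the whole space \<open>(1/2) *\<^sub>C (u + v)\<close> represents the
      functional sending \<open>x\<close> to \<open>cinner (S x) (S k)\<close>. Its projection
      \<open>z\<close> represents the same functional on \<open>K\<close> and lies in
      \<open>K\<close>, as the adjoint requires.\<close>
    obtain z where z: "z \<in> K" "\<And>m. m \<in> K \<Longrightarrow> cinner ((1/2) *\<^sub>C (u + v) - z) m = 0"
      using closed_csubspace_projection[OF K] by metis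
    have Sz: "cinner (S x) (S k) = cinner x z" if "x \<in> K" for x
    proof -
      have "cinner (S x) (S k) = cinner x ((1/2) *\<^sub>C (u + v))"
        unfolding S_def[of x]
        by (simp add: cinner_scaleC_left cinner_scaleC_right cinner_add_left cinner_add_right u v)
      then show ?thesis
        using cinner_eq_zero_sym[OF z(2)[OF that]] by (simp add: cinner_diff_right)
    qed
    have "adjoint_between K Mp S (S k) = z"
      by (rule adjoint_between_eqI[OF sub(3) S_Mp z(1) Sz])
    \<comment> \<open>By \<open>isometry_SD\<close>, the functional for \<open>D\<close> is the
      difference of those represented by \<open>k\<close> and \<open>z\<close>.\<close>
    moreover have "adjoint_between K Mm D (D k) = k - z"
    proof (rule adjoint_between_eqI[OF sub(3) D_Mm])
      show "k - z \<in> K" using k z(1) sub(3) by (rule complex_vector.subspace_diff[rotated])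
      show "cinner (D x) (D k) = cinner x (k - z)" if "x \<in> K" for x
        using isometry_SD[of x k] Sz[OF that] by (simp add: cinner_diff_right algebra_simps)
    qed
    ultimately show ?thesis by simp
  qed

  have S_Mm: "S x = 0" if "x \<in> Mm" for x
    using that by (simp add: S_def Mm_def)
  have D_Mp: "D x = 0" if "x \<in> Mp" for x
    using that by (simp add: D_def Mp_def)

  \<comment> \<open>On \<open>Mp\<close> the operator \<open>D\<close> vanishes and
    \<open>T1\<close> agrees with \<open>S\<close>, so \<open>isometry_SD\<close> reduces the claim
    to the orthogonality of \<open>K\<close> and \<open>Mp\<close>. The case of \<open>Mm\<close> is
    symmetric.\<close>
  have adjoint_Wp: "adjoint_between Mp Mp T1 (S k) = 0" if k: "k \<in> K" for k
  proof (rule adjoint_between_eqI[OF sub(1) S_Mp complex_vector.subspace_0[OF sub(1)]])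
    fix x assume x: "x \<in> Mp"
    then show "cinner (T1 x) (S k) = cinner x 0"
      using isometry_SD[of x k] cinner_eq_zero_sym[OF KMp[OF k x]]
      by (simp add: T1_eq D_Mp cinner_zero_left cinner_zero_right)
  qed
  have adjoint_Wm: "adjoint_between Mm Mm T1 (D k) = 0" if k: "k \<in> K" for k
  proof (rule adjoint_between_eqI[OF sub(2) D_Mm complex_vector.subspace_0[OF sub(2)]])
    fix x assume x: "x \<in> Mm"
    then show "cinner (T1 x) (D k) = cinner x 0"
      using isometry_SD[of x k] cinner_eq_zero_sym[OF KMm[OF k x]]
      by (simp add: T1_eq S_Mm cinner_zero_left cinner_zero_right)
  qed

  \<comment> \<open>The two block matrices\<close>
  have block1: "has_block_matrix [Mp, Mm, K]
      [[T1, \<lambda>_. 0, S], [\<lambda>_. 0, T1, D], [\<lambda>_. 0, \<lambda>_. 0, \<lambda>_. 0]] T1"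
    unfolding has_block_matrix_def
    \<comment> \<open>Fixing the index in \<open>T1_eq\<close> splits only the component in
      \<open>K\<close> into \<open>S\<close> and \<open>D\<close>; on the first two components
      \<open>T1\<close> is itself the diagonal entry.\<close>
    by (auto simp: less_Suc_eq eval_nat_numeral T1.add T1_eq[of "_ (Suc (Suc 0))"]
        intro: zero_op sub W_op S_op D_op)
  have T2_Mp: "T2 x = T1 x" if "x \<in> Mp" for x
    using that by (simp add: Mp_def)
  have T2_Mm: "T2 x = - T1 x" if "x \<in> Mm" for x
    using that by (simp add: Mm_def)
  have block2: "has_block_matrix [Mp, Mm, K]
      [[T1, \<lambda>_. 0, S], [\<lambda>_. 0, \<lambda>x. - T1 x, \<lambda>x. - D x], [\<lambda>_. 0, \<lambda>_. 0, \<lambda>_. 0]] T2"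
    unfolding has_block_matrix_def
    by (auto simp: less_Suc_eq eval_nat_numeral T2.add T2_Mp T2_Mm T2_eq[of "_ (Suc (Suc 0))"]
        intro: zero_op sub W_op S_op mW_op mD_op)

  show ?thesis
    using decomposition W S_op D_op adjoint_E adjoint_Wp adjoint_Wm block1 block2
    by blast
qed

end
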